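(* Let $\{X,\phi_i\}$ be a fundamental limit space for the finitely semicomponible closed injective system $\{X_i,Y_i,f_i\}$, in which each $X_i$ has the countable-perfect property $\mathfrak{P}$. Then $X$ has $\mathfrak{P}$.
   Context: $\mathbb{N}=\{0,1,2,\dots\}$. A closed injective system (CIS) $\{X_i,Y_i,f_i\}$ consists, for each $i\in\mathbb{N}$, of a nonempty topological space $X_i$, a closed subspace $Y_i\subset X_i$ and a closed injective continuous map $f_i:Y_i\to X_{i+1}$. Semicomponibility. Each $f_i$ is semicomponible with itself; put $Y_{i,i}=Y_i$, $f_{i,i}=f_i$. For $j>i$, inductively, $f_i$ and $f_j$ are semicomponible if $f_i$ and $f_{j-1}$ are semicomponible and $f_{i,j-1}(Y_{i,j-1})\cap Y_j\neq\emptyset$; in that case $Y_{i,j}=f_{i,j-1}^{-1}(Y_j)$ and $f_{i,j}:Y_{i,j}\to X_{j+1}$ is $f_{i,j}(y)=f_j(f_{i,j-1}(y))$. The CIS is finitely semicomponible if for every $i\in\mathbb{N}$ there are only finitely many $j\in\mathbb{N}$ such that $f_i$ and $f_j$ (or $f_j$ and $f_i$) are semicomponible. A limit space for the CIS is a topological space $X$ with continuous maps $\phi_i:X_i\to X$ ($i\in\mathbb{N}$) such that: (1) $X=\bigcup_{i}\phi_i(X_i)$; (2) each $\phi_i$ is an embedding (a homeomorphism onto its image); (3) if $i<j$ and $f_i$, $f_{j-1}$ are semicomponible, then $\phi_i(X_i)\cap\phi_j(X_j)=\phi_j(f_{i,j-1}(Y_{i,j-1}))$, and whenever $\phi_i(x_i)=\phi_j(x_j)$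 with $x_i\in X_i$, $x_j\in X_j$, one has $x_i\in Y_{i,j-1}$ and $x_j=f_{i,j-1}(x_i)$; (4) if $i<j$ and $f_i$, $f_{j-1}$ are not semicomponible, then $\phi_i(X_i)\cap\phi_j(X_j)=\emptyset$. A fundamental limit space is a limit space $\{X,\phi_i\}$ such that $X$ has the weak topology: a subset $A\subset X$ is closed in $X$ if and only if $\phi_i^{-1}(A)$ is closed in $X_i$ for all $i\in\mathbb{N}$. A continuous map $f:Z\to W$ is perfect if it is closed, surjective, and $f^{-1}(w)$ is compact for each $w\in W$. A property $\mathfrak{P}$ of topological spaces is perfect if whenever $\mathfrak{P}$ holds for $Z$ and there is a perfect map $Z\to W$, then $\mathfrak{P}$ holds for $W$. It is countable-perfect if it is perfect and whenever $\mathfrak{P}$ holds for each member of a countable collection $\{Z_n\}_n$ of spaces, it holds for the coproduct (topological sum) $\coprod_{n=0}^{\infty}Z_n$. *)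

theory Defs
  imports "HOL-Analysis.Analysis"
begin

text \<open>
  A subspace \<open>Y i\<close> is a subset of \<open>topspace (X i)\<close> carrying the subspace topology; the values of
  \<open>f i\<close> outside \<open>Y i\<close> are irrelevant.
\<close>

definition closed_injective_system ::
    "(nat \<Rightarrow> 'a topology) \<Rightarrow> (nat \<Rightarrow> 'a set) \<Rightarrow> (nat \<Rightarrow> 'a \<Rightarrow> 'a) \<Rightarrow> bool" where
  "closed_injective_system X Y f \<longleftrightarrow>
     (\<forall>i. topspace (X i) \<noteq> {} \<and>
          closedin (X i) (Y i) \<and>
          continuous_map (subtopology (X i) (Y i)) (X (Suc i)) (f i) \<and>
          closed_map (subtopology (X i) (Y i)) (X (Suc i)) (f i) \<and>
          inj_on (f i) (Y i))"

text \<open>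
  \<open>cis_map f i j\<close> and \<open>cis_dom Y f i j\<close> are $f_{i,j}$ and $Y_{i,j}$. They are meaningful only for
  \<open>i \<le> j\<close> with $f_i$ and $f_j$ semicomponible; for \<open>j < i\<close> they take the dummy values \<open>f i\<close> and \<open>Y i\<close>.
\<close>

primrec cis_map :: "(nat \<Rightarrow> 'a \<Rightarrow> 'a) \<Rightarrow> nat \<Rightarrow> nat \<Rightarrow> 'a \<Rightarrow> 'a" where
  "cis_map f i 0 = f i"
| "cis_map f i (Suc j) = (if i \<le> j then (\<lambda>y. f (Suc j) (cis_map f i j y)) else f i)"

primrec cis_dom :: "(nat \<Rightarrow> 'a set) \<Rightarrow> (nat \<Rightarrow> 'a \<Rightarrow> 'a) \<Rightarrow> nat \<Rightarrow> nat \<Rightarrow> 'a set" where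
  "cis_dom Y f i 0 = Y i"
| "cis_dom Y f i (Suc j) =
     (if i \<le> j then {y \<in> cis_dom Y f i j. cis_map f i j y \<in> Y (Suc j)} else Y i)"

text \<open>\<open>semicomponible Y f i j\<close> forces \<open>i \<le> j\<close>.\<close>

inductive semicomponible ::
    "(nat \<Rightarrow> 'a set) \<Rightarrow> (nat \<Rightarrow> 'a \<Rightarrow> 'a) \<Rightarrow> nat \<Rightarrow> nat \<Rightarrow> bool"
  for Y :: "nat \<Rightarrow> 'a set" and f :: "nat \<Rightarrow> 'a \<Rightarrow> 'a" where
  semicomponible_refl: "semicomponible Y f i i"
| semicomponible_step:
    "semicomponible Y f i j \<Longrightarrow> cis_map f i j ` cis_dom Y f i j \<inter> Y (Suc j) \<noteq> {}
     \<Longrightarrow> semicomponible Y f i (Suc j)"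

definition finitely_semicomponible ::
    "(nat \<Rightarrow> 'a set) \<Rightarrow> (nat \<Rightarrow> 'a \<Rightarrow> 'a) \<Rightarrow> bool" where
  "finitely_semicomponible Y f \<longleftrightarrow>
     (\<forall>i. finite {j. semicomponible Y f i j \<or> semicomponible Y f j i})"

definition limit_space ::
    "(nat \<Rightarrow> 'a topology) \<Rightarrow> (nat \<Rightarrow> 'a set) \<Rightarrow> (nat \<Rightarrow> 'a \<Rightarrow> 'a) \<Rightarrow>
     'b topology \<Rightarrow> (nat \<Rightarrow> 'a \<Rightarrow> 'b) \<Rightarrow> bool" where
  "limit_space X Y f L \<phi> \<longleftrightarrow>
     (\<forall>i. continuous_map (X i) L (\<phi> i)) \<and>
     topspace L = (\<Union>i. \<phi> i ` topspace (X i)) \<and>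
     (\<forall>i. embedding_map (X i) L (\<phi> i)) \<and>
     (\<forall>i j. i < j \<and> semicomponible Y f i (j - 1) \<longrightarrow>
        \<phi> i ` topspace (X i) \<inter> \<phi> j ` topspace (X j) =
          \<phi> j ` (cis_map f i (j - 1) ` cis_dom Y f i (j - 1)) \<and>
        (\<forall>x \<in> topspace (X i). \<forall>y \<in> topspace (X j). \<phi> i x = \<phi> j y \<longrightarrow>
           x \<in> cis_dom Y f i (j - 1) \<and> y = cis_map f i (j - 1) x)) \<and>
     (\<forall>i j. i < j \<and> \<not> semicomponible Y f i (j - 1) \<longrightarrow>
        \<phi> i ` topspace (X i) \<inter> \<phi> j ` topspace (X j) = {})"

definition fundamental_limit_space ::
    "(nat \<Rightarrow> 'a topology) \<Rightarrow> (nat \<Rightarrow> 'a set) \<Rightarrow> (nat \<Rightarrow> 'a \<Rightarrow> 'a) \<Rightarrow>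
     'b topology \<Rightarrow> (nat \<Rightarrow> 'a \<Rightarrow> 'b) \<Rightarrow> bool" where
  "fundamental_limit_space X Y f L \<phi> \<longleftrightarrow>
     limit_space X Y f L \<phi> \<and>
     (\<forall>A. A \<subseteq> topspace L \<longrightarrow>
        (closedin L A \<longleftrightarrow> (\<forall>i. closedin (X i) {x \<in> topspace (X i). \<phi> i x \<in> A})))"

text \<open>
  A property of topological spaces is a predicate on the topologies whose points lie in one
  universe type \<open>'u\<close>. The literal coproduct has points in \<open>nat \<times> 'u\<close>, so closure under countable
  coproducts is stated for its homeomorphic copies in \<open>'u\<close>; this loses nothing, because
  a perfect property is homeomorphism invariant, and copies exist whenever \<open>'u\<close> is infinite.
\<close>

definition perfect_property :: "('u topology \<Rightarrow> bool) \<Rightarrow> bool" where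
  "perfect_property P \<longleftrightarrow> (\<forall>Z W f. P Z \<and> perfect_map Z W f \<longrightarrow> P W)"

definition countable_perfect_property :: "('u topology \<Rightarrow> bool) \<Rightarrow> bool" where
  "countable_perfect_property P \<longleftrightarrow>
     perfect_property P \<and>
     (\<forall>(Z :: nat \<Rightarrow> 'u topology) W.
        (\<forall>n. P (Z n)) \<and> W homeomorphic_space sum_topology Z UNIV \<longrightarrow> P W)"

end

theory Submission
  imports Defs
begin

text \<open>
  The maps \<open>\<phi> i\<close> together define a map from the coproduct of the \<open>X i\<close> to the limit space. By finite
  semicomponibility, each \<open>\<phi> j ` X j\<close> meets only finitely many \<open>\<phi> i ` X i\<close>. Hence the fibres of this
  map are finite, and the \<open>\<phi> j\<close>-preimage of the image of a closed set is a finite union of sets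
  that are closed because the \<open>f\<^sub>i\<^sub>,\<^sub>j\<close> are closed and continuous; by the weak topology the map is
  closed. So the map is perfect.
\<close>

section \<open>The iterated maps and their domains\<close>

text \<open>Induction on \<open>j\<close>: the next map is \<open>f (Suc j)\<close> after the
  restriction of \<open>cis_map f i j\<close> to the preimage of the closed set
  \<open>Y (Suc j)\<close>. This preimage is closed, and restricting a closed map to a closed subset
  of its domain keeps it closed.\<close>

lemma cis_map_closed_injective:
  assumes cis: "closed_injective_system X Y f" and "i \<le> j"
  shows "closedin (X i) (cis_dom Y f i j) \<and>
    continuous_map (subtopology (X i) (cis_dom Y f i j)) (X (Suc j)) (cis_map f i j) \<and>
    closed_map (subtopology (X i) (cis_dom Y f i j)) (X (Suc j)) (cis_map f i j) \<and>
    inj_on (cis_map f i j) (cis_dom Y f i j)"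
  using \<open>i \<le> j\<close>
proof (induction j rule: dec_induct)
  case base
  \<comment> \<open>The recursion is on the second index. At \<open>i = Suc k\<close> its guard
    \<open>Suc k \<le> k\<close> fails, so the dummy branch supplies exactly the values
    \<open>Y i\<close> and \<open>f i\<close> wanted on the diagonal.\<close>
  have "cis_dom Y f i i = Y i" "cis_map f i i = f i"
    by (cases i; simp)+
  then show ?case
    using cis by (simp add: closed_injective_system_def)
next
  case (step j)
  let ?D = "cis_dom Y f i j" and ?g = "cis_map f i j"
  let ?D' = "{y \<in> ?D. ?g y \<in> Y (Suc j)}"
  have Y: "closedin (X (Suc j)) (Y (Suc j))"
    and contf: "continuous_map (subtopology (X (Suc j)) (Y (Suc j))) (X (Suc (Suc j))) (f (Suc j))"
    and closedf: "closed_map (subtopology (X (Suc j)) (Y (Suc j))) (X (Suc (Suc j))) (f (Suc j))"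
    and injf: "inj_on (f (Suc j)) (Y (Suc j))"
    using cis by (auto simp: closed_injective_system_def)
  have D: "closedin (X i) ?D"
    and contg: "continuous_map (subtopology (X i) ?D) (X (Suc j)) ?g"
    and closedg: "closed_map (subtopology (X i) ?D) (X (Suc j)) ?g"
    and injg: "inj_on ?g ?D"
    using step.IH by auto
  have topD: "topspace (subtopology (X i) ?D) = ?D"
    using closedin_subset[OF D] by (rule topspace_subtopology_subset)
  have D': "closedin (X i) ?D'"
    using closedin_continuous_map_preimage[OF contg Y] D closedin_trans_full topD by metis
  have contg': "continuous_map (subtopology (X i) ?D') (subtopology (X (Suc j)) (Y (Suc j))) ?g"
    using continuous_map_from_subtopology_mono[OF contg, of ?D']
    by (auto simp: continuous_map_in_subtopology)
  have "closed_map (subtopology (X i) ?D') (X (Suc (Suc j))) (f (Suc j) \<circ> ?g)"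
    unfolding closed_map_def
  proof (intro allI impI)
    fix C assume "closedin (subtopology (X i) ?D') C"
    then have C: "closedin (X i) C" "C \<subseteq> ?D'"
      using D' closedin_closed_subtopology by blast+
    then have "closedin (subtopology (X i) ?D) C"
      using D closedin_closed_subtopology by blast
    then have "closedin (X (Suc j)) (?g ` C)"
      using closedg by (simp add: closed_map_def)
    moreover have "?g ` C \<subseteq> Y (Suc j)"
      using C by auto
    ultimately have "closedin (subtopology (X (Suc j)) (Y (Suc j))) (?g ` C)"
      using Y closedin_closed_subtopology by blast
    then have "closedin (X (Suc (Suc j))) (f (Suc j) ` ?g ` C)"
      using closedf unfolding closed_map_def by blast
    then show "closedin (X (Suc (Suc j))) ((f (Suc j) \<circ> ?g) ` C)"
      by (simp only: image_comp)
  qed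
  moreover have "inj_on (f (Suc j) \<circ> ?g) ?D'"
    using injf injg by (auto simp: inj_on_def)
  ultimately show ?case
    using D' continuous_map_compose[OF contg' contf] step.hyps by (simp add: comp_def)
qed

section \<open>How the pieces meet inside the limit space\<close>

text \<open>This is the gluing relation point by point; the index is \<open>j - 1\<close> because
  \<open>cis_map f i (j - 1)\<close> lands in \<open>X j\<close>. From left to right it is the
  definition of a limit space. The converse needs an argument, since the definition only equates an
  intersection with an image.\<close>

lemma limit_space_pair_eq_iff:
  assumes cis: "closed_injective_system X Y f" and lim: "limit_space X Y f L \<phi>"
    and "i < j" and x: "x \<in> topspace (X i)" and y: "y \<in> topspace (X j)"
  shows "\<phi> i x = \<phi> j y \<longleftrightarrow>
    semicomponible Y f i (j - 1) \<and> x \<in> cis_dom Y f i (j - 1) \<and> y = cis_map f i (j - 1) x"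
proof
  assume eq: "\<phi> i x = \<phi> j y"
  then have "\<phi> i ` topspace (X i) \<inter> \<phi> j ` topspace (X j) \<noteq> {}"
    using x y by (metis IntI empty_iff imageI)
  then have "semicomponible Y f i (j - 1)"
    using lim \<open>i < j\<close> unfolding limit_space_def by blast
  then show "semicomponible Y f i (j - 1) \<and> x \<in> cis_dom Y f i (j - 1) \<and> y = cis_map f i (j - 1) x"
    using lim \<open>i < j\<close> x y eq unfolding limit_space_def by blast
next
  assume R: "semicomponible Y f i (j - 1) \<and> x \<in> cis_dom Y f i (j - 1) \<and> y = cis_map f i (j - 1) x"
  then have "\<phi> j y \<in> \<phi> i ` topspace (X i)"
    using lim \<open>i < j\<close> unfolding limit_space_def by blast
  \<comment> \<open>A priori \<open>x'\<close> is some other point of \<open>X i\<close> glued to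
    \<open>y\<close>. Both \<open>x\<close> and \<open>x'\<close> are sent to \<open>y\<close> by
    the injective map \<open>cis_map f i (j - 1)\<close>, so they coincide.\<close>
  then obtain x' where x': "x' \<in> topspace (X i)" "\<phi> i x' = \<phi> j y"
    by auto
  then have "x' \<in> cis_dom Y f i (j - 1)" "y = cis_map f i (j - 1) x'"
    using lim R \<open>i < j\<close> y unfolding limit_space_def by blast+
  moreover have "inj_on (cis_map f i (j - 1)) (cis_dom Y f i (j - 1))"
    using cis_map_closed_injective[OF cis, of i "j - 1"] \<open>i < j\<close> by simp
  ultimately have "x' = x"
    using R by (auto simp: inj_on_def)
  then show "\<phi> i x = \<phi> j y"
    using x' by simp
qed

lemma limit_space_inj_on:
  assumes "limit_space X Y f L \<phi>"
  shows "inj_on (\<phi> i) (topspace (X i))"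
proof -
  have "embedding_map (X i) L (\<phi> i)"
    using assms by (simp add: limit_space_def)
  then show ?thesis
    unfolding embedding_map_def by (rule homeomorphic_imp_injective_map)
qed

text \<open>Only indices \<open>i\<close> above \<open>j\<close> matter. For these, meeting piece
  \<open>j\<close> forces \<open>f j\<close> and \<open>f (i - 1)\<close> to be semicomponible,
  which leaves finitely many \<open>i - 1\<close>; hence the shift by \<open>Suc\<close> in the
  bound.\<close>

lemma finite_meeting_pieces:
  assumes fin: "finitely_semicomponible Y f" and lim: "limit_space X Y f L \<phi>"
  shows "finite {i. \<phi> i ` topspace (X i) \<inter> \<phi> j ` topspace (X j) \<noteq> {}}"
proof (rule finite_subset)
  let ?S = "{k. semicomponible Y f j k \<or> semicomponible Y f k j}"
  show "finite ({..j} \<union> Suc ` ?S)"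
    using fin by (simp add: finitely_semicomponible_def)
  have "i \<in> Suc ` ?S" if "\<not> i \<le> j" and "\<phi> i ` topspace (X i) \<inter> \<phi> j ` topspace (X j) \<noteq> {}" for i
  proof -
    have "\<phi> j ` topspace (X j) \<inter> \<phi> i ` topspace (X i) \<noteq> {}" "j < i"
      using that by auto
    then have "semicomponible Y f j (i - 1)"
      using lim unfolding limit_space_def by blast
    moreover have "i = Suc (i - 1)"
      using that(1) by simp
    ultimately show ?thesis
      by blast
  qed
  then show "{i. \<phi> i ` topspace (X i) \<inter> \<phi> j ` topspace (X j) \<noteq> {}} \<subseteq> {..j} \<union> Suc ` ?S"
    by auto
qed

lemma finite_pieces_containing_point:
  assumes "finitely_semicomponible Y f" and "limit_space X Y f L \<phi>"
  shows "finite {i. x \<in> \<phi> i ` topspace (X i)}"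
proof (cases "\<exists>j. x \<in> \<phi> j ` topspace (X j)")
  case True
  then obtain j where "x \<in> \<phi> j ` topspace (X j)" ..
  then have "{i. x \<in> \<phi> i ` topspace (X i)} \<subseteq> {i. \<phi> i ` topspace (X i) \<inter> \<phi> j ` topspace (X j) \<noteq> {}}"
    by auto
  then show ?thesis
    using finite_meeting_pieces[OF assms] finite_subset by blast
qed auto

text \<open>By the gluing relation the set is \<open>A\<close> itself if \<open>i = j\<close>, the
  image of a closed set under a closed iterated map if \<open>i < j\<close>, and the preimage of
  \<open>A\<close> under a continuous iterated map if \<open>j < i\<close>. In the last two cases it
  is empty when semicomponibility fails.\<close>

lemma closedin_preimage_piece_image:
  assumes cis: "closed_injective_system X Y f" and lim: "limit_space X Y f L \<phi>"
    and A: "closedin (X i) A"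
  shows "closedin (X j) {y \<in> topspace (X j). \<phi> j y \<in> \<phi> i ` A}"
proof -
  have AX: "A \<subseteq> topspace (X i)"
    using A closedin_subset by blast
  note eq_iff = limit_space_pair_eq_iff[OF cis lim]
  consider (eq) "i = j" | (less) "i < j" | (greater) "j < i"
    by linarith
  then show ?thesis
  proof cases
    case eq
    then have "{y \<in> topspace (X j). \<phi> j y \<in> \<phi> i ` A} = A"
      using limit_space_inj_on[OF lim, of i] AX by (auto simp: inj_on_def)
    then show ?thesis
      using A eq by simp
  next
    case less
    let ?D = "cis_dom Y f i (j - 1)" and ?g = "cis_map f i (j - 1)"
    have D: "closedin (X i) ?D" and g: "closed_map (subtopology (X i) ?D) (X j) ?g"
      using cis_map_closed_injective[OF cis, of i "j - 1"] less by simp_all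
    have "closedin (subtopology (X i) ?D) (A \<inter> ?D)"
      using A D closedin_closed_subtopology by blast
    then have closed: "closedin (X j) (?g ` (A \<inter> ?D))"
      using g by (simp add: closed_map_def)
    have "\<phi> j y \<in> \<phi> i ` A \<longleftrightarrow> semicomponible Y f i (j - 1) \<and> y \<in> ?g ` (A \<inter> ?D)"
      if y: "y \<in> topspace (X j)" for y
    proof -
      have "\<phi> j y \<in> \<phi> i ` A \<longleftrightarrow> (\<exists>x\<in>A. \<phi> i x = \<phi> j y)"
        by (metis imageE imageI)
      also have "\<dots> \<longleftrightarrow> (\<exists>x\<in>A. semicomponible Y f i (j - 1) \<and> x \<in> ?D \<and> y = ?g x)"
        using eq_iff[OF less _ y] AX by (intro bex_cong) auto
      finally show ?thesis
        by auto
    qed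
    then have "{y \<in> topspace (X j). \<phi> j y \<in> \<phi> i ` A}
        = (if semicomponible Y f i (j - 1) then ?g ` (A \<inter> ?D) else {})"
      using closedin_subset[OF closed] by auto
    then show ?thesis
      using closed by simp
  next
    case greater
    let ?D = "cis_dom Y f j (i - 1)" and ?g = "cis_map f j (i - 1)"
    have D: "closedin (X j) ?D" and g: "continuous_map (subtopology (X j) ?D) (X i) ?g"
      using cis_map_closed_injective[OF cis, of j "i - 1"] greater by simp_all
    have "topspace (subtopology (X j) ?D) = ?D"
      using closedin_subset[OF D] by (rule topspace_subtopology_subset)
    then have closed: "closedin (X j) {y \<in> ?D. ?g y \<in> A}"
      using closedin_continuous_map_preimage[OF g A] D closedin_trans_full by metis
    have "\<phi> j y \<in> \<phi> i ` A \<longleftrightarrow> semicomponible Y f j (i - 1) \<and> y \<in> ?D \<and> ?g y \<in> A"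
      if y: "y \<in> topspace (X j)" for y
    proof -
      have "\<phi> j y \<in> \<phi> i ` A \<longleftrightarrow> (\<exists>x\<in>A. \<phi> j y = \<phi> i x)"
        by (simp add: image_iff)
      also have "\<dots> \<longleftrightarrow> (\<exists>x\<in>A. semicomponible Y f j (i - 1) \<and> y \<in> ?D \<and> x = ?g y)"
        using eq_iff[OF greater y] AX by (intro bex_cong) auto
      finally show ?thesis
        by auto
    qed
    then have "{y \<in> topspace (X j). \<phi> j y \<in> \<phi> i ` A}
        = (if semicomponible Y f j (i - 1) then {y \<in> ?D. ?g y \<in> A} else {})"
      using closedin_subset[OF D] by auto
    then show ?thesis
      using closed by simp
  qed
qed

section \<open>The perfect map from the coproduct\<close>

lemma perfect_map_sum_topology_fundamental_limit_space:
  assumes cis: "closed_injective_system X Y f" and fin: "finitely_semicomponible Y f"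
    and fund: "fundamental_limit_space X Y f L \<phi>"
  shows "perfect_map (sum_topology X UNIV) L (\<lambda>(i, x). \<phi> i x)"
proof -
  let ?S = "sum_topology X UNIV" and ?q = "\<lambda>(i, x). \<phi> i x"
  have lim: "limit_space X Y f L \<phi>"
    using fund by (simp add: fundamental_limit_space_def)
  have weak: "closedin L A" if "A \<subseteq> topspace L"
    and "\<And>i. closedin (X i) {x \<in> topspace (X i). \<phi> i x \<in> A}" for A
    using fund that by (simp add: fundamental_limit_space_def)
  have topL: "topspace L = (\<Union>i. \<phi> i ` topspace (X i))"
    and cont: "continuous_map (X i) L (\<phi> i)" for i
    using lim by (auto simp: limit_space_def)
  have "continuous_map ?S L ?q"
    unfolding continuous_map_closedin
  proof (intro conjI allI impI)
    show "?q \<in> topspace ?S \<rightarrow> topspace L"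
      by (auto simp: topL)
    fix C assume "closedin L C"
    then have "closedin (X i) {x \<in> topspace (X i). \<phi> i x \<in> C}" for i
      using closedin_continuous_map_preimage[OF cont] by blast
    then show "closedin ?S {p \<in> topspace ?S. ?q p \<in> C}"
      by (auto simp: closedin_sum_topology)
  qed
  moreover have "?q ` topspace ?S = topspace L"
    by (force simp: topL)
  moreover have "closed_map ?S L ?q"
    unfolding closed_map_def
  proof (intro allI impI)
    fix C assume C: "closedin ?S C"
    \<comment> \<open>The slices of \<open>C\<close>: a set of points of the coproduct is closed
      exactly when each of its slices is closed.\<close>
    define A where "A i = {x. (i, x) \<in> C}" for i
    have A: "closedin (X i) (A i)" for i
      using C by (simp add: closedin_sum_topology A_def)
    have AX: "A i \<subseteq> topspace (X i)" for i
      using A closedin_subset by blast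
    have qC: "?q ` C = (\<Union>i. \<phi> i ` A i)"
      by (force simp: A_def)
    show "closedin L (?q ` C)"
    proof (rule weak)
      show "?q ` C \<subseteq> topspace L"
        using AX by (auto simp: qC topL)
      fix j
      \<comment> \<open>Pieces outside \<open>?I\<close> contribute no point to the preimage in
        \<open>X j\<close>, so the union over all \<open>i\<close> shrinks to a finite one.\<close>
      let ?I = "{i. \<phi> i ` topspace (X i) \<inter> \<phi> j ` topspace (X j) \<noteq> {}}"
      have "{x \<in> topspace (X j). \<phi> j x \<in> ?q ` C}
          = (\<Union>i\<in>?I. {x \<in> topspace (X j). \<phi> j x \<in> \<phi> i ` A i})"
        using AX unfolding qC by blast
      moreover have "closedin (X j) \<dots>"
        using finite_meeting_pieces[OF fin lim] closedin_preimage_piece_image[OF cis lim A]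
        by (intro closedin_Union) auto
      ultimately show "closedin (X j) {x \<in> topspace (X j). \<phi> j x \<in> ?q ` C}"
        by simp
    qed
  qed
  moreover have "compactin ?S {p \<in> topspace ?S. ?q p = w}" for w
  proof (rule finite_imp_compactin)
    \<comment> \<open>Each \<open>\<phi> i\<close> is injective, so a summand contains at most one
      point over \<open>w\<close>; only finitely many summands contain any.\<close>
    have "finite {x \<in> topspace (X i). \<phi> i x = w}" for i
      using finite_vimage_IntI[OF _ limit_space_inj_on[OF lim], of "{w}" i]
      by (simp add: vimage_def Int_def conj_commute)
    then have "finite (SIGMA i:{i. w \<in> \<phi> i ` topspace (X i)}. {x \<in> topspace (X i). \<phi> i x = w})"
      using finite_pieces_containing_point[OF fin lim] by (intro finite_SigmaI) auto
    then show "finite {p \<in> topspace ?S. ?q p = w}"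
      by (rule rev_finite_subset) auto
  qed auto
  ultimately show ?thesis
    by (simp add: perfect_map_def proper_map_def)
qed

section \<open>Moving the coproduct into the universe of the spaces\<close>

text \<open>Used to copy the coproduct, whose points are pairs, onto the type over which the
  property is stated. The open sets of the pullback are the preimages under \<open>h\<close>, and
  surjectivity of \<open>h\<close> recovers an open set from its preimage.\<close>

lemma homeomorphic_map_pullback_topology:
  assumes "bij h"
  shows "homeomorphic_map (pullback_topology UNIV h T) T h"
proof (rule bijective_open_imp_homeomorphic_map)
  show "continuous_map (pullback_topology UNIV h T) T h"
    using continuous_map_pullback[OF continuous_map_id, of UNIV h T] by simp
  show "open_map (pullback_topology UNIV h T) T h"
    using assms by (auto simp: open_map_def openin_pullback_topology bij_is_surj)
  show "h ` topspace (pullback_topology UNIV h T) = topspace T"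
    using assms by (simp add: topspace_pullback_topology bij_is_surj)
  show "inj_on h (topspace (pullback_topology UNIV h T))"
    using assms bij_is_inj inj_on_subset by blast
qed

text \<open>Cardinal arithmetic: an infinite cardinal absorbs multiplication by the countable
  cardinal of \<open>nat\<close>.\<close>

lemma infinite_bij_nat_Times:
  includes cardinal_syntax
  assumes "infinite (UNIV :: 'u set)"
  obtains h :: "'u \<Rightarrow> nat \<times> 'u" where "bij h"
proof -
  have "|UNIV :: nat set| \<le>o |UNIV :: 'u set|"
    using assms infinite_iff_card_of_nat by blast
  then have "|(UNIV :: nat set) \<times> (UNIV :: 'u set)| =o |UNIV :: 'u set|"
    using card_of_Times_infinite[OF assms] by blast
  then have "|UNIV :: 'u set| =o |UNIV :: (nat \<times> 'u) set|"
    using ordIso_symmetric by (simp add: UNIV_Times_UNIV)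
  then show thesis
    using that card_of_ordIso by metis
qed

text \<open>
  If the universe were finite, some point of it would lie in infinitely many of the nonempty sets
  \<open>\<phi> i ` X i\<close>.
\<close>
lemma infinite_universe_of_limit_space:
  fixes \<phi> :: "nat \<Rightarrow> 'a \<Rightarrow> 'b"
  assumes cis: "closed_injective_system X Y f" and fin: "finitely_semicomponible Y f"
    and lim: "limit_space X Y f L \<phi>"
  shows "infinite (UNIV :: 'b set)"
proof
  assume "finite (UNIV :: 'b set)"
  then have "finite (\<Union>x::'b. {i. x \<in> \<phi> i ` topspace (X i)})"
    using finite_pieces_containing_point[OF fin lim] by blast
  \<comment> \<open>Every index occurs, because \<open>X i\<close> is nonempty and so
    \<open>\<phi> i\<close> has a value.\<close>
  moreover have "(\<Union>x::'b. {i. x \<in> \<phi> i ` topspace (X i)}) = UNIV"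
    using cis by (force simp: closed_injective_system_def)
  ultimately show False
    by simp
qed

theorem theorem11p7:
  fixes X :: "nat \<Rightarrow> 'u topology" and Y :: "nat \<Rightarrow> 'u set" and f :: "nat \<Rightarrow> 'u \<Rightarrow> 'u"
    and L :: "'u topology" and \<phi> :: "nat \<Rightarrow> 'u \<Rightarrow> 'u"
    and P :: "'u topology \<Rightarrow> bool"
  assumes "closed_injective_system X Y f"
    and "finitely_semicomponible Y f"
    and "fundamental_limit_space X Y f L \<phi>"
    and "countable_perfect_property P"
    and "\<forall>i. P (X i)"
  shows "P L"
proof -
  have "limit_space X Y f L \<phi>"
    using assms(3) by (simp add: fundamental_limit_space_def)
  then obtain h :: "'u \<Rightarrow> nat \<times> 'u" where "bij h"
    using infinite_universe_of_limit_space infinite_bij_nat_Times assms(1,2) by metis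
  \<comment> \<open>\<open>W\<close> is the copy of the coproduct on \<open>'u\<close>. It has
    \<open>P\<close> by closure under coproducts, and following the homeomorphism \<open>h\<close>
    by the perfect map from the coproduct carries \<open>P\<close> on to \<open>L\<close>.\<close>
  define W where "W = pullback_topology UNIV h (sum_topology X UNIV)"
  have h: "homeomorphic_map W (sum_topology X UNIV) h"
    unfolding W_def using \<open>bij h\<close> by (rule homeomorphic_map_pullback_topology)
  then have "P W"
    using assms(4,5) homeomorphic_map_imp_homeomorphic_space
    unfolding countable_perfect_property_def by blast
  moreover have "perfect_map W L ((\<lambda>(i, x). \<phi> i x) \<circ> h)"
    using homeomorphic_imp_perfect_map[OF h]
      perfect_map_sum_topology_fundamental_limit_space[OF assms(1-3)]
    by (rule perfect_map_compose)
  ultimately show "P L"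
    using assms(4) unfolding countable_perfect_property_def perfect_property_def by blast
qed

end
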